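(* Suppose that $\ell_i\in\mathcal C^2(\mathcal X,\mathbb R)$ for all $i\in[n]$, that the nominal costs $\{\ell_i\}_{i\in[n]}$ are diagonally strictly convex, and that $x^\dagger\in\operatorname{int}\mathcal X$. Then the affine incentive law $$\gamma_i^*(x)=p_i^*x_i+(u_i^\dagger-p_i^*x_i^\dagger),\qquad p_i^*:=-\frac{\partial \ell_i}{\partial x_i}(x^\dagger),\qquad i\in[n],$$ is an optimal solution to the Incentive Design problem with desired profile $(x^\dagger,u^\dagger)$, in the sense that $\gamma^*=(\gamma_i^* )_{i\in[n]}$ is a solution of the Incentive Design problem and, for any other solution $\gamma\in\Gamma$ of the Incentive Design problem, $$\gamma_i^*(x)\le\gamma_i(x)\qquad\forall x\in\mathcal X,\ \forall i\in[n].$$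
   Context: There are $n$ agents, $[n]=\{1,\dots,n\}$. Agent $i$ chooses $x_i\in\mathcal X_i$, where $\mathcal X_i\subset\mathbb R$ is compact and convex; $\mathcal X=\prod_{i\in[n]}\mathcal X_i$. Agent $i$ has a nominal cost $\ell_i:\mathcal X\to\mathbb R$. Given an incentive law $\gamma=(\gamma_i)_{i\in[n]}:\mathcal X\to\mathbb R^n$, agent $i$ minimizes $c_i^\gamma(x)=\ell_i(x)+\gamma_i(x)$. A strategy $x\in\mathcal X$ is an Incentivized Nash Equilibrium (INE) for $\gamma$ if for each $i\in[n]$, $c_i^\gamma(x_i,x_{-i})\le c_i^\gamma(x_i',x_{-i})$ for all $x_i'\in\mathcal X_i$, where $x_{-i}=(x_j)_{j\ne i}$. Incentive Design problem: given a desired action profile $(x^\dagger,u^\dagger)\in\mathcal X\times\mathbb R^n$, find an incentive law $\gamma:\mathcal X\to\mathbb R^n$ such that (i) $x^\dagger$ is an INE of the game with costs $c_i^\gamma$, and (ii) $\gamma(x^\dagger)=u^\dagger$. The incentive class is $\Gamma=\{\gamma\in\mathcal C^2(\mathcal X,\mathbb R^n):\ \frac{\partial}{\partial x_j}\gamma_i(x)=0,\ \frac{\partial^2}{\partial x_i^2}\gamma_i(x)\ge 0,\ \forall i\ne j,\ \forall x\in\mathcal X\}$. Let $G_0(x)=\big(\frac{\partial \ell_1}{\partial x_1}(x),\dots,\frac{\partial \ell_n}{\partial x_n}(x)\big)^\top$, let $\nabla G_0$ be its Jacobian, and for a square matrix $A$ let $\operatorname{Sym}(A)=\frac12(A+A^\top)$.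 The costs $\{\ell_i\}$ are diagonally strictly convex if there is a diagonal matrix $R$ with positive diagonal entries such that $\operatorname{Sym}(R\nabla G_0(x))\succ0$ for all $x\in\mathcal X$. *)

theory Defs
  imports "HOL-Analysis.Analysis"
begin

text \<open>
  The agents are the elements of a finite type \<open>'n\<close>, an action profile is a vector of type
  \<open>real ^ 'n\<close>, and \<open>X i\<close> is the action set of agent \<open>i\<close>. Costs and incentive laws are total functions,
  but every notion below depends only on their values on \<open>profiles X\<close>.
\<close>

definition profiles :: "('n::finite \<Rightarrow> real set) \<Rightarrow> (real ^ 'n) set" where
  "profiles X = {x. \<forall>i. x $ i \<in> X i}"

text \<open>\<open>deviate x i y\<close> is the profile $(y, x_{-i})$.\<close>

definition deviate :: "real ^ 'n \<Rightarrow> 'n::finite \<Rightarrow> real \<Rightarrow> real ^ 'n" where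
  "deviate x i y = (\<chi> j. if j = i then y else x $ j)"

text \<open>
  Partial derivatives are taken within the action set, hence one-sided at its end points. The value
  is meaningful only if this derivative exists and \<open>x $ j\<close> is a limit point of \<open>X j\<close>. The latter
  holds for all \<open>x \<in> profiles X\<close> when each \<open>X j\<close> is convex and \<open>profiles X\<close> has nonempty interior.
\<close>

definition partial_deriv ::
    "('n::finite \<Rightarrow> real set) \<Rightarrow> (real ^ 'n \<Rightarrow> real) \<Rightarrow> 'n \<Rightarrow> real ^ 'n \<Rightarrow> real" where
  "partial_deriv X f j x = vector_derivative (\<lambda>t. f (deviate x j t)) (at (x $ j) within X j)"

text \<open>
  Twice continuous differentiability on a set \<open>S\<close> that need not be open, by Frechet derivatives
  within \<open>S\<close>. Continuity of \<open>f\<close> and \<open>f'\<close> on \<open>S\<close> is implied.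
\<close>

definition C2_on :: "'a::real_normed_vector set \<Rightarrow> ('a \<Rightarrow> 'b::real_normed_vector) \<Rightarrow> bool" where
  "C2_on S f \<longleftrightarrow>
     (\<exists>(f' :: 'a \<Rightarrow> 'a \<Rightarrow>\<^sub>L 'b) (f'' :: 'a \<Rightarrow> 'a \<Rightarrow>\<^sub>L ('a \<Rightarrow>\<^sub>L 'b)).
        (\<forall>x\<in>S. (f has_derivative blinfun_apply (f' x)) (at x within S)) \<and>
        (\<forall>x\<in>S. (f' has_derivative blinfun_apply (f'' x)) (at x within S)) \<and>
        continuous_on S f'')"

definition incentivized_cost ::
    "('n::finite \<Rightarrow> real ^ 'n \<Rightarrow> real) \<Rightarrow> (real ^ 'n \<Rightarrow> real ^ 'n) \<Rightarrow> 'n \<Rightarrow> real ^ 'n \<Rightarrow> real" where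
  "incentivized_cost l \<gamma> i x = l i x + \<gamma> x $ i"

definition incentivized_nash_equilibrium ::
    "('n::finite \<Rightarrow> real set) \<Rightarrow> ('n \<Rightarrow> real ^ 'n \<Rightarrow> real) \<Rightarrow> (real ^ 'n \<Rightarrow> real ^ 'n)
      \<Rightarrow> real ^ 'n \<Rightarrow> bool" where
  "incentivized_nash_equilibrium X l \<gamma> x \<longleftrightarrow>
     x \<in> profiles X \<and>
     (\<forall>i. \<forall>y\<in>X i. incentivized_cost l \<gamma> i x \<le> incentivized_cost l \<gamma> i (deviate x i y))"

definition solves_incentive_design ::
    "('n::finite \<Rightarrow> real set) \<Rightarrow> ('n \<Rightarrow> real ^ 'n \<Rightarrow> real) \<Rightarrow> real ^ 'n \<Rightarrow> real ^ 'n
      \<Rightarrow> (real ^ 'n \<Rightarrow> real ^ 'n) \<Rightarrow> bool" where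
  "solves_incentive_design X l xd ud \<gamma> \<longleftrightarrow>
     incentivized_nash_equilibrium X l \<gamma> xd \<and> \<gamma> xd = ud"

definition incentive_class ::
    "('n::finite \<Rightarrow> real set) \<Rightarrow> (real ^ 'n \<Rightarrow> real ^ 'n) set" where
  "incentive_class X =
     {\<gamma>. C2_on (profiles X) \<gamma> \<and>
         (\<forall>i j. i \<noteq> j \<longrightarrow> (\<forall>x\<in>profiles X. partial_deriv X (\<lambda>z. \<gamma> z $ i) j x = 0)) \<and>
         (\<forall>i. \<forall>x\<in>profiles X. partial_deriv X (partial_deriv X (\<lambda>z. \<gamma> z $ i) i) i x \<ge> 0)}"

definition pseudo_gradient ::
    "('n::finite \<Rightarrow> real set) \<Rightarrow> ('n \<Rightarrow> real ^ 'n \<Rightarrow> real) \<Rightarrow> real ^ 'n \<Rightarrow> real ^ 'n" where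
  "pseudo_gradient X l x = (\<chi> i. partial_deriv X (l i) i x)"

definition sym_part :: "real ^ 'n ^ 'n \<Rightarrow> real ^ 'n ^ 'n" where
  "sym_part A = (1 / 2) *\<^sub>R (A + transpose A)"

definition positive_definite :: "real ^ 'n ^ 'n::finite \<Rightarrow> bool" where
  "positive_definite A \<longleftrightarrow> transpose A = A \<and> (\<forall>v. v \<noteq> 0 \<longrightarrow> v \<bullet> (A *v v) > 0)"

definition diagonally_strictly_convex ::
    "('n::finite \<Rightarrow> real set) \<Rightarrow> ('n \<Rightarrow> real ^ 'n \<Rightarrow> real) \<Rightarrow> bool" where
  "diagonally_strictly_convex X l \<longleftrightarrow>
     (\<exists>R :: real ^ 'n ^ 'n.
        (\<forall>i j. i \<noteq> j \<longrightarrow> R $ i $ j = 0) \<and> (\<forall>i. R $ i $ i > 0) \<and>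
        (\<forall>x\<in>profiles X.
           positive_definite
             (sym_part (R ** jacobian (pseudo_gradient X l) (at x within profiles X)))))"

definition affine_incentive ::
    "('n::finite \<Rightarrow> real set) \<Rightarrow> ('n \<Rightarrow> real ^ 'n \<Rightarrow> real) \<Rightarrow> real ^ 'n \<Rightarrow> real ^ 'n
      \<Rightarrow> real ^ 'n \<Rightarrow> real ^ 'n" where
  "affine_incentive X l xd ud x =
     (\<chi> i. let p = - partial_deriv X (l i) i xd in p * x $ i + (ud $ i - p * xd $ i))"

end

theory Submission
  imports Defs
begin

text \<open>
  The affine incentive of agent \<open>i\<close> has slope exactly cancelling the marginal nominal cost at the
  desired profile, so both claims reduce to tangent inequalities in the agent's own action.

  \<^emph>\<open>The affine law is a solution.\<close> Testing diagonal strict convexity on the \<open>i\<close>-th unit vector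
  shows that the \<open>i\<close>-th diagonal entry of the Jacobian of the pseudo-gradient, which is the second
  partial derivative of \<open>l i\<close> in its own variable, is positive
  (\<open>diagonally_strictly_convex_second_partial_pos\<close>). Hence \<open>l i\<close> lies above its tangent in the
  \<open>i\<close>-th coordinate direction (\<open>tangent_le_along_coordinate\<close>), and adding the affine incentive turns
  this tangent into a constant.

  \<^emph>\<open>It is a minimal one.\<close> If \<open>\<gamma>\<close> is another solution in the class, then the total cost of agent
  \<open>i\<close> is minimal at an interior point, so its derivative there vanishes
  (\<open>partial_deriv_sum_zero_at_interior_min\<close>), which forces \<open>\<gamma>\<^sub>i\<close> to have the slope of the
  affine law at the desired profile; both also have the same value there. So the affine law is the
  tangent of \<open>\<gamma>\<^sub>i\<close>. As \<open>\<gamma>\<^sub>i\<close> is convex in the own action and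
  depends on nothing else (\<open>eq_deviate_if_other_partials_zero\<close>), it lies above that tangent.
\<close>

section \<open>Unilateral deviations\<close>

lemma deviate_eq_add_axis: "deviate x i t = x + (t - x $ i) *\<^sub>R axis i 1"
  by (auto simp: deviate_def vec_eq_iff axis_def)

lemma deviate_nth_same [simp]: "deviate x i t $ i = t"
  and deviate_deviate_same [simp]: "deviate (deviate x i t) i s = deviate x i s"
  and deviate_self [simp]: "deviate x i (x $ i) = x"
  by (auto simp: deviate_def vec_eq_iff)

lemma deviate_in_profiles: "x \<in> profiles X \<Longrightarrow> t \<in> X i \<Longrightarrow> deviate x i t \<in> profiles X"
  by (auto simp: profiles_def deviate_def)

lemma nth_in_if_profile: "x \<in> profiles X \<Longrightarrow> x $ i \<in> X i"
  by (simp add: profiles_def)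

lemma convex_profiles:
  assumes "\<And>i. convex (X i)"
  shows "convex (profiles X)"
  using assms by (auto simp: profiles_def convex_def)

lemma nth_in_interior_if_interior_profiles:
  assumes "x \<in> interior (profiles X)"
  shows "x $ i \<in> interior (X i)"
proof -
  obtain e where e: "e > 0" "ball x e \<subseteq> profiles X"
    using assms by (auto simp: mem_interior)
  have "ball (x $ i) e \<subseteq> X i"
  proof
    fix t assume "t \<in> ball (x $ i) e"
    then have "deviate x i t \<in> ball x e"
      by (simp add: deviate_eq_add_axis dist_norm abs_minus_commute)
    then show "t \<in> X i"
      using e nth_in_if_profile[of "deviate x i t" X i] by auto
  qed
  with e show ?thesis by (auto simp: mem_interior)
qed

text \<open>
  This is what makes the partial derivatives within the action sets, end points included, uniquely
  determined.
\<close>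

lemma islimpt_action_set:
  assumes "convex (X i)" "interior (profiles X) \<noteq> {}" "t \<in> X i"
  shows "t islimpt X i"
proof (rule connected_imp_perfect)
  show "connected (X i)" using assms(1) by (rule convex_connected)
  have "interior (X i) \<noteq> {}"
    using assms(2) nth_in_interior_if_interior_profiles by fastforce
  then show "X i \<noteq> {a}" for a by auto
qed (fact assms(3))

section \<open>Partial derivatives within the set of profiles\<close>

lemma has_real_derivative_along_coordinate:
  assumes "(f has_derivative D) (at x within profiles X)" "x \<in> profiles X"
  shows "((\<lambda>t. f (deviate x j t)) has_real_derivative D (axis j 1)) (at (x $ j) within X j)"
proof -
  have "((deviate x j) has_derivative (\<lambda>h. h *\<^sub>R axis j 1)) (at (x $ j) within X j)"
    unfolding deviate_eq_add_axis[abs_def] by (auto intro!: derivative_eq_intros)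
  moreover have "(f has_derivative D) (at (deviate x j (x $ j)) within deviate x j ` X j)"
    using assms deviate_in_profiles[OF assms(2)]
    by (auto intro: has_derivative_subset)
  ultimately have "((\<lambda>t. f (deviate x j t)) has_derivative (\<lambda>h. D (h *\<^sub>R axis j 1)))
      (at (x $ j) within X j)"
    by (rule has_derivative_in_compose)
  then show ?thesis
    using linear_scale[OF has_derivative_linear[OF assms(1)]]
    by (simp add: has_field_derivative_def mult.commute[of _ "D _"])
qed

lemma partial_deriv_eq:
  assumes "(f has_derivative D) (at x within profiles X)" "x \<in> profiles X" "x $ j islimpt X j"
  shows "partial_deriv X f j x = D (axis j 1)"
  unfolding partial_deriv_def
  using assms has_real_derivative_along_coordinate[OF assms(1,2), of j]
  by (intro vector_derivative_within[rotated])
    (auto simp: has_real_derivative_iff_has_vector_derivative trivial_limit_within)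

lemma has_real_derivative_partial_deriv:
  assumes "f differentiable_on profiles X" "x \<in> profiles X" "t \<in> X j"
    and "t islimpt X j"
  shows "((\<lambda>s. f (deviate x j s)) has_real_derivative partial_deriv X f j (deviate x j t))
    (at t within X j)"
proof -
  have y: "deviate x j t \<in> profiles X" using assms by (simp add: deviate_in_profiles)
  then obtain D where D: "(f has_derivative D) (at (deviate x j t) within profiles X)"
    using assms(1) by (auto simp: differentiable_on_def differentiable_def)
  show ?thesis
    using has_real_derivative_along_coordinate[OF D y, of j] partial_deriv_eq[OF D y, of j] assms
    by simp
qed

section \<open>Twice continuously differentiable functions\<close>

lemma C2_on_imp_differentiable_on: "C2_on S f \<Longrightarrow> f differentiable_on S"
  by (auto simp: C2_on_def differentiable_on_def differentiable_def)

lemma C2_on_bounded_linear: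
  fixes f :: "'a::real_normed_vector \<Rightarrow> 'b::real_normed_vector"
  assumes "bounded_linear L" "C2_on S f"
  shows "C2_on S (\<lambda>x. L (f x))"
proof -
  obtain f' f'' where
    f': "\<And>x. x \<in> S \<Longrightarrow> (f has_derivative blinfun_apply (f' x)) (at x within S)" and
    f'': "\<And>x. x \<in> S \<Longrightarrow> (f' has_derivative blinfun_apply (f'' x)) (at x within S)" and
    cont: "continuous_on S f''"
    using assms(2) unfolding C2_on_def by blast
  define B where "B = Blinfun L"
  have B: "blinfun_apply B = L" using assms(1) by (simp add: B_def bounded_linear_Blinfun_apply)
  have bl: "bounded_linear (\<lambda>A :: 'a \<Rightarrow>\<^sub>L 'b. B o\<^sub>L A)"
    by (rule bounded_bilinear.bounded_linear_right[OF bounded_bilinear_blinfun_compose])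
  define C where "C = Blinfun (\<lambda>A :: 'a \<Rightarrow>\<^sub>L 'b. B o\<^sub>L A)"
  have C: "blinfun_apply C = (\<lambda>A. B o\<^sub>L A)"
    unfolding C_def using bl by (rule bounded_linear_Blinfun_apply)
  show ?thesis
    unfolding C2_on_def
  proof (intro exI conjI ballI)
    fix x assume x: "x \<in> S"
    show "((\<lambda>x. L (f x)) has_derivative blinfun_apply (B o\<^sub>L f' x)) (at x within S)"
      using bounded_linear.has_derivative[OF assms(1) f'[OF x]] by (simp add: B blinfun_compose.rep_eq comp_def)
    show "((\<lambda>x. B o\<^sub>L f' x) has_derivative blinfun_apply (C o\<^sub>L f'' x)) (at x within S)"
      using bounded_linear.has_derivative[OF bl f''[OF x]] by (simp add: C blinfun_compose.rep_eq comp_def)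
  next
    show "continuous_on S (\<lambda>x. C o\<^sub>L f'' x)"
      using cont by (intro continuous_intros)
  qed
qed

lemma C2_on_partial_deriv_differentiable_on:
  fixes f :: "real ^ 'n::finite \<Rightarrow> real"
  assumes "C2_on (profiles X) f" and lim: "\<And>t. t \<in> X j \<Longrightarrow> t islimpt X j"
  shows "partial_deriv X f j differentiable_on profiles X"
proof -
  obtain f' f'' where
    f': "\<And>x. x \<in> profiles X \<Longrightarrow>
      (f has_derivative blinfun_apply (f' x)) (at x within profiles X)" and
    f'': "\<And>x. x \<in> profiles X \<Longrightarrow>
      (f' has_derivative blinfun_apply (f'' x)) (at x within profiles X)"
    using assms(1) unfolding C2_on_def by blast
  have eq: "partial_deriv X f j x = blinfun_apply (f' x) (axis j 1)" if "x \<in> profiles X" for x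
    using that partial_deriv_eq[OF f'] lim nth_in_if_profile by blast
  have "(partial_deriv X f j has_derivative (\<lambda>v. blinfun_apply (blinfun_apply (f'' x) v) (axis j 1)))
      (at x within profiles X)" if "x \<in> profiles X" for x
  proof (rule has_derivative_transform[OF that])
    show "((\<lambda>x. blinfun_apply (f' x) (axis j 1)) has_derivative
        (\<lambda>v. blinfun_apply (blinfun_apply (f'' x) v) (axis j 1))) (at x within profiles X)"
      by (rule bounded_linear.has_derivative[OF _ f''[OF that]])
        (rule bounded_bilinear.bounded_linear_left[OF bounded_bilinear_blinfun_apply])
  qed (simp add: eq)
  then show ?thesis by (auto simp: differentiable_on_def differentiable_def)
qed

section \<open>Convexity in one coordinate\<close>

text \<open>
  The one-dimensional lemma needs derivatives within the convex set only, so that it applies up to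
  the boundary of the action sets.
\<close>

lemma tangent_le_if_second_derivative_nonneg:
  fixes f :: "real \<Rightarrow> real"
  assumes "convex S" "s \<in> S" "t \<in> S"
    and f': "\<And>x. x \<in> S \<Longrightarrow> (f has_real_derivative f' x) (at x within S)"
    and f'': "\<And>x. x \<in> S \<Longrightarrow> (f' has_real_derivative f'' x) (at x within S)"
    and nonneg: "\<And>x. x \<in> S \<Longrightarrow> 0 \<le> f'' x"
  shows "f s + f' s * (t - s) \<le> f t"
proof -
  have mvt: "\<exists>z\<in>{a<..<b}. g b - g a = (b - a) * g' z"
    if "a < b" "a \<in> S" "b \<in> S"
      and g': "\<And>x. x \<in> S \<Longrightarrow> (g has_real_derivative g' x) (at x within S)"
    for a b and g g' :: "real \<Rightarrow> real"
  proof -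
    have "{a..b} \<subseteq> S"
      using that assms(1) by (metis closed_segment_eq_real_ivl1 closed_segment_subset less_imp_le)
    then have "\<And>x. x \<in> {a..b} \<Longrightarrow> (g has_derivative (\<lambda>h. h * g' x)) (at x within {a..b})"
      using g' by (metis has_derivative_subset has_field_derivative_def mult_commute_abs subsetD)
    from mvt_simple[OF \<open>a < b\<close> this] show ?thesis by auto
  qed
  have sub: "{min s t..max s t} \<subseteq> S"
    using assms(1-3) by (metis closed_segment_eq_real_ivl closed_segment_subset max.commute
        max_def min_def)
  have mono: "f' a \<le> f' b" if "a \<le> b" "a \<in> S" "b \<in> S" for a b
  proof (cases "a = b")
    case False
    with that have "a < b" by simp
    from mvt[OF this that(2,3) f''] obtain z
      where z: "z \<in> {a<..<b}" "f' b - f' a = (b - a) * f'' z" by blast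
    then have "z \<in> S"
      using that assms(1) closed_segment_subset[of a S b]
      by (auto simp: closed_segment_eq_real_ivl split: if_splits)
    then show ?thesis
      using z that nonneg[of z] mult_nonneg_nonneg[of "b - a" "f'' z"] by linarith
  qed simp
  consider "s < t" | "s = t" | "t < s" by linarith
  then show ?thesis
  proof cases
    case 1
    from mvt[OF this assms(2,3) f'] obtain z
      where z: "z \<in> {s<..<t}" "f t - f s = (t - s) * f' z" by blast
    then have "(t - s) * f' s \<le> (t - s) * f' z"
      using sub assms by (intro mult_left_mono mono) auto
    then show ?thesis using z by (simp add: algebra_simps)
  next
    case 3
    from mvt[OF this assms(3,2) f'] obtain z
      where z: "z \<in> {t<..<s}" "f s - f t = (s - t) * f' z" by blast
    then have "(s - t) * f' z \<le> (s - t) * f' s"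
      using sub assms by (intro mult_left_mono mono) auto
    then show ?thesis using z by (simp add: algebra_simps)
  qed simp
qed

lemma tangent_le_along_coordinate:
  fixes f :: "real ^ 'n::finite \<Rightarrow> real"
  assumes "convex (X i)" and lim: "\<And>t. t \<in> X i \<Longrightarrow> t islimpt X i"
    and f: "C2_on (profiles X) f"
    and nonneg: "\<And>y. y \<in> profiles X \<Longrightarrow> 0 \<le> partial_deriv X (partial_deriv X f i) i y"
    and x: "x \<in> profiles X" and t: "t \<in> X i"
  shows "f x + partial_deriv X f i x * (t - x $ i) \<le> f (deviate x i t)"
proof -
  have "f (deviate x i (x $ i)) + partial_deriv X f i (deviate x i (x $ i)) * (t - x $ i)
      \<le> f (deviate x i t)"
  proof (rule tangent_le_if_second_derivative_nonneg[where S = "X i" and f = "\<lambda>s. f (deviate x i s)"])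
    fix s assume s: "s \<in> X i"
    show "((\<lambda>s. f (deviate x i s)) has_real_derivative partial_deriv X f i (deviate x i s))
        (at s within X i)"
      using C2_on_imp_differentiable_on[OF f] x s lim[OF s]
      by (rule has_real_derivative_partial_deriv)
    show "((\<lambda>s. partial_deriv X f i (deviate x i s)) has_real_derivative
        partial_deriv X (partial_deriv X f i) i (deviate x i s)) (at s within X i)"
      using C2_on_partial_deriv_differentiable_on[OF f lim] x s lim[OF s]
      by (rule has_real_derivative_partial_deriv)
    show "0 \<le> partial_deriv X (partial_deriv X f i) i (deviate x i s)"
      using nonneg deviate_in_profiles[OF x s] .
  qed (use assms x nth_in_if_profile in auto)
  then show ?thesis by simp
qed

text \<open>
  The quadratic form of \<open>R ** J\<close> at a unit vector is \<open>R $ i $ i * J $ i $ i\<close>, and the symmetric part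
  has the same quadratic form. So the positive diagonal scaling \<open>R\<close> does not affect the sign of the
  diagonal of \<open>J\<close>.
\<close>

lemma diagonally_strictly_convex_second_partial_pos:
  fixes X :: "'n::finite \<Rightarrow> real set"
  assumes lim: "\<And>i t. t \<in> X i \<Longrightarrow> t islimpt X i"
    and l: "\<And>i. C2_on (profiles X) (l i)"
    and conv: "diagonally_strictly_convex X l"
    and x: "x \<in> profiles X"
  shows "0 < partial_deriv X (partial_deriv X (l i) i) i x"
proof -
  define J where "J = jacobian (pseudo_gradient X l) (at x within profiles X)"
  obtain R :: "real ^ 'n ^ 'n" where
    diag: "\<And>i j. i \<noteq> j \<Longrightarrow> R $ i $ j = 0" and pos: "\<And>i. R $ i $ i > 0" and
    pd: "positive_definite (sym_part (R ** J))"
    using conv x unfolding diagonally_strictly_convex_def J_def by blast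
  have RJ: "(R ** J) $ i $ i = R $ i $ i * J $ i $ i"
  proof -
    have "(R ** J) $ i $ i = (\<Sum>k\<in>UNIV. R $ i $ k * J $ k $ i)"
      by (simp add: matrix_matrix_mult_def)
    also have "\<dots> = (\<Sum>k\<in>UNIV. if k = i then R $ i $ i * J $ i $ i else 0)"
      by (intro sum.cong) (auto simp: diag)
    finally show ?thesis by simp
  qed
  have "axis i 1 \<bullet> (sym_part (R ** J) *v axis i 1) > 0"
    using pd unfolding positive_definite_def by (simp add: axis_eq_0_iff)
  also have "axis i 1 \<bullet> (sym_part (R ** J) *v axis i 1) = R $ i $ i * J $ i $ i"
    by (simp add: inner_axis' matrix_vector_mul_component inner_axis sym_part_def transpose_def RJ)
  finally have "J $ i $ i > 0" using pos[of i] by (simp add: zero_less_mult_iff)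
  have "pseudo_gradient X l differentiable at x within profiles X"
  proof -
    have "(\<lambda>z. pseudo_gradient X l z $ k) differentiable at x within profiles X" for k
      using C2_on_partial_deriv_differentiable_on[OF l lim, of k k] x
      by (simp add: pseudo_gradient_def differentiable_on_def)
    then show ?thesis
      by (subst differentiable_componentwise_within) (auto simp: Basis_vec_def inner_axis)
  qed
  then have "(pseudo_gradient X l has_derivative
      frechet_derivative (pseudo_gradient X l) (at x within profiles X)) (at x within profiles X)"
    by (simp add: frechet_derivative_works)
  from bounded_linear.has_derivative[OF bounded_linear_vec_nth[of i] this]
  have "(partial_deriv X (l i) i has_derivative
      (\<lambda>v. frechet_derivative (pseudo_gradient X l) (at x within profiles X) v $ i))
      (at x within profiles X)"
    by (simp add: pseudo_gradient_def comp_def)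
  from partial_deriv_eq[OF this x] lim nth_in_if_profile[OF x]
  have "partial_deriv X (partial_deriv X (l i) i) i x = J $ i $ i"
    by (simp add: J_def jacobian_def matrix_def)
  with \<open>J $ i $ i > 0\<close> show ?thesis by simp
qed

section \<open>Incentives that depend on the own action only\<close>

text \<open>
  The two profiles differ by a vector orthogonal to the \<open>i\<close>-th axis, and the derivative of \<open>f\<close>
  vanishes in the direction of every other axis. So \<open>f\<close> is constant on the segment between them.
\<close>

lemma eq_deviate_if_other_partials_zero:
  fixes f :: "real ^ 'n::finite \<Rightarrow> real"
  assumes conv: "\<And>j. convex (X j)" and lim: "\<And>j t. t \<in> X j \<Longrightarrow> t islimpt X j"
    and diff: "f differentiable_on profiles X"
    and zero: "\<And>j z. j \<noteq> i \<Longrightarrow> z \<in> profiles X \<Longrightarrow> partial_deriv X f j z = 0"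
    and x: "x \<in> profiles X" and y: "y \<in> profiles X"
  shows "f x = f (deviate y i (x $ i))"
proof -
  define w where "w = deviate y i (x $ i)"
  have w: "w \<in> profiles X"
    unfolding w_def using x y by (simp add: deviate_in_profiles nth_in_if_profile)
  let ?p = "\<lambda>s::real. w + s *\<^sub>R (x - w)"
  have p: "?p s \<in> profiles X" if "s \<in> {0..1}" for s
  proof -
    have "?p s = (1 - s) *\<^sub>R w + s *\<^sub>R x" by (simp add: algebra_simps)
    then show ?thesis
      using convexD[OF convex_profiles[of X, OF conv] w x, of "1 - s" s] that by simp
  qed
  have "((\<lambda>s. f (?p s)) has_derivative (\<lambda>h. 0)) (at s within {0..1})" if s: "s \<in> {0..1}" for s
  proof -
    obtain D where D: "(f has_derivative D) (at (?p s) within profiles X)"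
      using diff p[OF s] by (auto simp: differentiable_on_def differentiable_def)
    interpret D: bounded_linear D using D by (rule has_derivative_bounded_linear)
    have axis: "D (axis j 1) = 0" if "j \<noteq> i" for j
      using partial_deriv_eq[OF D p[OF s], of j] zero[OF that p[OF s]] lim
        nth_in_if_profile[OF p[OF s]] by simp
    have "D (x - w) = D (\<Sum>j\<in>UNIV. (x - w) $ j *\<^sub>R axis j 1)"
      by (subst basis_expansion[of "x - w", unfolded scalar_mult_eq_scaleR, symmetric]) simp
    also have "\<dots> = (\<Sum>j\<in>UNIV. (x - w) $ j *\<^sub>R D (axis j 1))"
      by (simp only: D.sum D.scaleR)
    also have "\<dots> = 0"
    proof (intro sum.neutral ballI)
      fix j show "(x - w) $ j *\<^sub>R D (axis j 1) = 0"
        by (cases "j = i") (auto simp: axis w_def)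
    qed
    finally have dir: "D (x - w) = 0" .
    have "(?p has_derivative (\<lambda>h. h *\<^sub>R (x - w))) (at s within {0..1})"
      by (auto intro!: derivative_eq_intros)
    moreover have "(f has_derivative D) (at (?p s) within ?p ` {0..1})"
      using D by (rule has_derivative_subset) (use p in auto)
    ultimately have "((\<lambda>s. f (?p s)) has_derivative (\<lambda>h. D (h *\<^sub>R (x - w)))) (at s within {0..1})"
      by (rule has_derivative_in_compose)
    then show ?thesis by (simp add: D.scaleR dir)
  qed
  from mvt_simple[OF zero_less_one this] have "f x = f w" by auto
  then show ?thesis by (simp add: w_def)
qed

section \<open>Optimality of the affine incentive\<close>

lemma partial_deriv_sum_zero_at_interior_min:
  assumes f: "f differentiable_on profiles X" and g: "g differentiable_on profiles X"
    and x: "x \<in> interior (profiles X)"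
    and lim: "\<And>t. t \<in> X i \<Longrightarrow> t islimpt X i"
    and min: "\<And>t. t \<in> X i \<Longrightarrow> f x + g x \<le> f (deviate x i t) + g (deviate x i t)"
  shows "partial_deriv X f i x + partial_deriv X g i x = 0"
proof -
  have xi: "x $ i \<in> interior (X i)" using x by (rule nth_in_interior_if_interior_profiles)
  then obtain e where e: "e > 0" "ball (x $ i) e \<subseteq> X i" by (auto simp: mem_interior)
  have "x \<in> profiles X" "x $ i \<in> X i" using x xi interior_subset by auto
  from has_real_derivative_partial_deriv[OF f this lim[OF this(2)]]
    has_real_derivative_partial_deriv[OF g this lim[OF this(2)]]
  have "((\<lambda>t. f (deviate x i t) + g (deviate x i t)) has_real_derivative
      partial_deriv X f i x + partial_deriv X g i x) (at (x $ i))"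
    using DERIV_add by (fastforce simp: at_within_interior[OF xi])
  then show ?thesis
    by (rule DERIV_local_min[OF _ e(1)]) (use e min in \<open>auto simp: subset_iff dist_real_def\<close>)
qed

theorem lemma1:
  fixes X :: "'n::finite \<Rightarrow> real set"
    and l :: "'n \<Rightarrow> real ^ 'n \<Rightarrow> real"
    and xd ud :: "real ^ 'n"
  assumes "\<And>i. compact (X i)"
    and "\<And>i. convex (X i)"
    and "\<And>i. C2_on (profiles X) (l i)"
    and "diagonally_strictly_convex X l"
    and "xd \<in> interior (profiles X)"
  shows "solves_incentive_design X l xd ud (affine_incentive X l xd ud) \<and>
    (\<forall>\<gamma>\<in>incentive_class X. solves_incentive_design X l xd ud \<gamma> \<longrightarrow>
      (\<forall>x\<in>profiles X. \<forall>i. affine_incentive X l xd ud x $ i \<le> \<gamma> x $ i))"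
proof (intro conjI ballI impI allI)
  have lim: "\<And>i t. t \<in> X i \<Longrightarrow> t islimpt X i"
    using islimpt_action_set assms(2,5) by blast
  have xd: "xd \<in> profiles X" using assms(5) interior_subset by auto
  have affine: "affine_incentive X l xd ud x $ i
      = ud $ i - partial_deriv X (l i) i xd * (x $ i - xd $ i)" for x i
    by (simp add: affine_incentive_def Let_def algebra_simps)
  show "solves_incentive_design X l xd ud (affine_incentive X l xd ud)"
    unfolding solves_incentive_design_def incentivized_nash_equilibrium_def
  proof (intro conjI allI ballI)
    show "affine_incentive X l xd ud xd = ud" by (simp add: vec_eq_iff affine)
    fix i y assume "y \<in> X i"
    then have "l i xd + partial_deriv X (l i) i xd * (y - xd $ i) \<le> l i (deviate xd i y)"
      using diagonally_strictly_convex_second_partial_pos[OF lim assms(3,4)]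
      by (intro tangent_le_along_coordinate assms lim xd) (auto intro: less_imp_le)
    then show "incentivized_cost l (affine_incentive X l xd ud) i xd
        \<le> incentivized_cost l (affine_incentive X l xd ud) i (deviate xd i y)"
      by (simp add: incentivized_cost_def affine)
  qed (fact xd)
  fix \<gamma> x i
  assume "\<gamma> \<in> incentive_class X" and sol: "solves_incentive_design X l xd ud \<gamma>"
    and x: "x \<in> profiles X"
  then have C2: "C2_on (profiles X) (\<lambda>z. \<gamma> z $ i)"
    and zero: "\<And>j z. j \<noteq> i \<Longrightarrow> z \<in> profiles X \<Longrightarrow> partial_deriv X (\<lambda>z. \<gamma> z $ i) j z = 0"
    and nonneg: "\<And>z. z \<in> profiles X \<Longrightarrow>
      0 \<le> partial_deriv X (partial_deriv X (\<lambda>z. \<gamma> z $ i) i) i z"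
    by (auto simp: incentive_class_def intro: C2_on_bounded_linear[OF bounded_linear_vec_nth])
  have slope: "partial_deriv X (l i) i xd + partial_deriv X (\<lambda>z. \<gamma> z $ i) i xd = 0"
    using sol
    by (intro partial_deriv_sum_zero_at_interior_min C2_on_imp_differentiable_on C2 assms lim)
      (auto simp: solves_incentive_design_def incentivized_nash_equilibrium_def
        incentivized_cost_def)
  have "affine_incentive X l xd ud x $ i
      = \<gamma> xd $ i + partial_deriv X (\<lambda>z. \<gamma> z $ i) i xd * (x $ i - xd $ i)"
    using slope sol by (simp add: affine solves_incentive_design_def eq_neg_iff_add_eq_0[symmetric])
  also have "\<dots> \<le> \<gamma> (deviate xd i (x $ i)) $ i"
    by (rule tangent_le_along_coordinate[where f = "\<lambda>z. \<gamma> z $ i"])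
      (use assms lim C2 nonneg xd x nth_in_if_profile in auto)
  also have "\<dots> = \<gamma> x $ i"
    using eq_deviate_if_other_partials_zero[where f = "\<lambda>z. \<gamma> z $ i", OF assms(2) lim
        C2_on_imp_differentiable_on[OF C2] zero x xd] by simp
  finally show "affine_incentive X l xd ud x $ i \<le> \<gamma> x $ i" .
qed

end
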